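(* Let $\Gamma$ be an (additively written) abelian group endowed with a linear ordering relation, let $(x_s\mid s\in S)$ be a finite non-empty family of elements of $\Gamma$, and let $k\ge 1$ be an integer. Then $$\sum_{\substack{A\subseteq S\\ |A|\ge k}} (-1)^{|A|-k}\,\min\nolimits_k(x_a\mid a\in A)=\binom{|S|-1}{k-1}\max(x_s\mid s\in S).$$
   Context: For $A\subseteq S$ with $|A|\ge k$, $\min_k(x_a\mid a\in A)$ denotes the $k$-th smallest element in the family $(x_a\mid a\in A)$ (counted with multiplicity). Integer multiples of elements of $\Gamma$ are taken in the usual sense of an abelian group. *)

theory Defs
  imports Complex_Main "HOL-Library.Multiset"
begin

definition int_mult :: "int \<Rightarrow> 'g::ab_group_add \<Rightarrow> 'g"
  where "int_mult n g = (if n \<ge> 0 then (\<Sum>i<nat n. g) else - (\<Sum>i<nat (- n). g))"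

(* Positions in lists are 0-based, so the k-th smallest entry sits at position k - 1.
   Meaningful only if A is finite and 1 \<le> k \<le> card A. *)
definition min_kth :: "nat \<Rightarrow> ('s \<Rightarrow> 'g::linorder) \<Rightarrow> 's set \<Rightarrow> 'g"
  where "min_kth k x A = sorted_list_of_multiset (image_mset x (mset_set A)) ! (k - 1)"

end

theory Submission
  imports Defs
begin

text \<open>
  Let \<open>m\<close> be an index at which \<open>x\<close> is maximal, and pair every \<open>B \<subseteq> S - {m}\<close> with \<open>insert m B\<close>.
  Appending a maximal value to a sorted list does not disturb the earlier positions, so both sets
  have the same \<open>k\<close>-th smallest value as soon as \<open>card B \<ge> k\<close>
  (\<open>min_kth_insert_max\<close>); their cardinalities differ by one, so their
  contributions cancel. The only terms that survive come from the sets \<open>insert m B\<close> with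
  \<open>card B = k - 1\<close>. Each has the maximum as its \<open>k\<close>-th smallest value, with sign \<open>+1\<close>, and there are
  \<open>(card S - 1) choose (k - 1)\<close> of them.
\<close>

lemma int_mult_1: "int_mult 1 g = g"
  by (simp add: int_mult_def)

lemma int_mult_minus: "int_mult (- n) g = - int_mult n g"
  by (simp add: int_mult_def)

lemma sum_constant_int_mult:
  assumes "finite U"
  shows "(\<Sum>u\<in>U. g) = int_mult (int (card U)) g"
proof -
  obtain h where "bij_betw h {0..<card U} U"
    using ex_bij_betw_nat_finite[OF assms] by blast
  from sum.reindex_bij_betw[OF this, of "\<lambda>_. g"] show ?thesis
    by (simp add: int_mult_def lessThan_atLeast0)
qed

text \<open>A largest value is sorted into the last position, \<open>card B\<close> when counting from \<open>0\<close>, and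
  all earlier entries stay where they were.\<close>

lemma min_kth_insert_max:
  assumes "finite B" and "m \<notin> B" and "\<And>b. b \<in> B \<Longrightarrow> x b \<le> x m" and "k \<ge> 1"
  shows "k \<le> card B \<Longrightarrow> min_kth k x (insert m B) = min_kth k x B"
    and "card B = k - 1 \<Longrightarrow> min_kth k x (insert m B) = x m"
proof -
  have "sorted_list_of_multiset (image_mset x (mset_set (insert m B)))
      = sorted_list_of_multiset (image_mset x (mset_set B)) @ [x m]"
    using assms by (simp add: sorted_insort_is_snoc)
  moreover have "length (sorted_list_of_multiset (image_mset x (mset_set B))) = card B"
    by (metis mset_sorted_list_of_multiset size_image_mset size_mset size_mset_set)
  ultimately show "k \<le> card B \<Longrightarrow> min_kth k x (insert m B) = min_kth k x B"
    and "card B = k - 1 \<Longrightarrow> min_kth k x (insert m B) = x m"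
    using \<open>k \<ge> 1\<close> by (auto simp: min_kth_def nth_append)
qed

theorem mainTheorem5:
  fixes S :: "'s set" and x :: "'s \<Rightarrow> 'g::{ab_group_add, linorder}" and k :: nat
  assumes "finite S" and "S \<noteq> {}" and "k \<ge> 1"
  shows "(\<Sum>A | A \<subseteq> S \<and> card A \<ge> k. int_mult ((- 1) ^ (card A - k)) (min_kth k x A))
    = int_mult (int ((card S - 1) choose (k - 1))) (Max (x ` S))"
proof -
  have "Max (x ` S) \<in> x ` S"
    using assms by simp
  then obtain m where m: "m \<in> S" and max: "x m = Max (x ` S)"
    by auto
  define T where "T = S - {m}"
  have T: "finite T" "m \<notin> T" "S = insert m T" "card T = card S - 1"
    using assms m by (auto simp: T_def)
  define f where "f A = int_mult ((- 1) ^ (card A - k)) (min_kth k x A)" for A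
  \<comment> \<open>Both a set in \<open>P\<close> and its partner are large enough to occur in the sum; for a set in \<open>Q\<close> only
    the partner is, which is why its term has nothing to cancel against.\<close>
  define P where "P = {B. B \<subseteq> T \<and> card B \<ge> k}"
  define Q where "Q = {B. B \<subseteq> T \<and> card B = k - 1}"
  have fin: "finite P" "finite Q"
    using T(1) by (auto simp: P_def Q_def)
  have le: "x b \<le> x m" if "b \<in> T" for b
    using that assms(1) unfolding max T_def by simp
  have sub: "finite B" "m \<notin> B" "\<And>b. b \<in> B \<Longrightarrow> x b \<le> x m" "card (insert m B) = Suc (card B)"
    if "B \<subseteq> T" for B
    proof -
    show "finite B" "m \<notin> B"
      using that T by (auto dest: finite_subset)
    then show "card (insert m B) = Suc (card B)"
      by simp
    show "\<And>b. b \<in> B \<Longrightarrow> x b \<le> x m"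
      using that le by blast
  qed
  have cancel: "f (insert m B) = - f B" if "B \<in> P" for B
  proof -
    have B: "B \<subseteq> T" "k \<le> card B"
      using that by (auto simp: P_def)
    then show ?thesis
      using min_kth_insert_max(1)[where x = x, OF sub(1-3)[OF B(1)] \<open>k \<ge> 1\<close> B(2)] sub(4)[OF B(1)]
      by (simp add: f_def Suc_diff_le int_mult_minus)
  qed
  have survive: "f (insert m B) = x m" if "B \<in> Q" for B
  proof -
    have B: "B \<subseteq> T" "card B = k - 1"
      using that by (auto simp: Q_def)
    then show ?thesis
      using min_kth_insert_max(2)[where x = x, OF sub(1-3)[OF B(1)] \<open>k \<ge> 1\<close> B(2)] sub(4)[OF B(1)] \<open>k \<ge> 1\<close>
      by (simp add: f_def int_mult_1)
  qed
  have split: "{A. A \<subseteq> S \<and> card A \<ge> k} = P \<union> insert m ` (P \<union> Q)"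
  proof (intro set_eqI iffI)
    fix A assume A: "A \<in> {A. A \<subseteq> S \<and> card A \<ge> k}"
    show "A \<in> P \<union> insert m ` (P \<union> Q)"
    proof (cases "m \<in> A")
      case True
      then have "A - {m} \<subseteq> T" "A = insert m (A - {m})"
        using A T(3) by auto
      moreover from this have "card A = Suc (card (A - {m}))"
        using sub(4) by metis
      ultimately have "A - {m} \<in> P \<union> Q"
        using A by (auto simp: P_def Q_def)
      then show ?thesis
        using \<open>A = insert m (A - {m})\<close> by blast
    next
      case False
      then show ?thesis
        using A T(3) by (auto simp: P_def)
    qed
  next
    fix A assume "A \<in> P \<union> insert m ` (P \<union> Q)"
    then show "A \<in> {A. A \<subseteq> S \<and> card A \<ge> k}"
      using T(3) sub(4) by (auto simp: P_def Q_def)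
  qed
  have inj: "inj_on (insert m) (P \<union> Q)"
    using T(2) by (auto simp: inj_on_def P_def Q_def)
  have "(\<Sum>A | A \<subseteq> S \<and> card A \<ge> k. f A) = sum f P + sum f (insert m ` (P \<union> Q))"
    unfolding split using fin T(2) by (intro sum.union_disjoint) (auto simp: P_def)
  also have "sum f (insert m ` (P \<union> Q)) = (\<Sum>B\<in>P \<union> Q. f (insert m B))"
    using inj by (simp add: sum.reindex)
  also have "\<dots> = (\<Sum>B\<in>P. f (insert m B)) + (\<Sum>B\<in>Q. f (insert m B))"
    using fin \<open>k \<ge> 1\<close> by (intro sum.union_disjoint) (auto simp: P_def Q_def)
  also have "\<dots> = - sum f P + (\<Sum>B\<in>Q. x m)"
    by (simp add: cancel survive sum_negf)
  also have "sum f P + (- sum f P + (\<Sum>B\<in>Q. x m)) = int_mult (int (card Q)) (x m)"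
    using fin by (simp add: sum_constant_int_mult)
  also have "card Q = (card S - 1) choose (k - 1)"
    using n_subsets[OF T(1), of "k - 1"] T(4) by (simp add: Q_def)
  finally show ?thesis
    unfolding f_def max .
qed

end
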